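(* The combinatorial principle $\diamondsuit(\mathrm{hom}_{\mathrm{H}})$ implies the existence of a stable ordered-union ultrafilter on $[\omega]^{<\omega}$ of character $\omega_1$.
   Context: $[\omega]^{<\omega}$ is the set of finite subsets of $\omega$. For $X\subseteq[\omega]^{<\omega}$, $\mathrm{FU}(X)=\{\bigcup F : F\in[X]^{<\omega}\setminus\{\varnothing\}\}$. A family $X\subseteq[\omega]^{<\omega}$ is ordered (a block sequence) if for all distinct $x,y\in X$, either $\max(x)<\min(y)$ or $\max(y)<\min(x)$. A set $A\subseteq[\omega]^{<\omega}$ is FU-reaped by a block sequence $X$ if $\mathrm{FU}(X)\subseteq A$ or $\mathrm{FU}(X)\cap A=\varnothing$. The principle $\diamondsuit(\mathrm{hom}_{\mathrm{H}})$ states: for every Borel function $F:2^{<\omega_1}\to\mathcal P([\omega]^{<\omega})$ (Borel meaning that for each $\alpha<\omega_1$ the restriction of $F$ to $2^{\alpha}$ is Borel, with $\mathcal P([\omega]^{<\omega})$ identified with $2^\omega$), there is a function $g$ from $\omega_1$ to the set of infinite block sequences such that for every $f:\omega_1\to 2$ the set $\{\alpha<\omega_1 : F(f\restriction\alpha)\text{ is FU-reaped by }g(\alpha)\}$ is stationary. An ultrafilter $u$ on $[\omega]^{<\omega}$ is a union ultrafilter if for every $A\in u$ there is an infinite pairwise disjoint $X\subseteq[\omega]^{<\omega}$ with $\mathrm{FU}(X)\subseteq A$ and $\mathrm{FU}(X)\in u$; it is an ordered-union ultrafilter if for every $A\in u$ there is an infinite ordered $X$ with $\mathrm{FU}(X)\subseteq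 A$ and $\mathrm{FU}(X)\in u$. A union ultrafilter $u$ is stable if for every countable collection $\{X_n:n<\omega\}$ of pairwise disjoint families with $\mathrm{FU}(X_n)\in u$ for all $n$, there is a pairwise disjoint $X$ with $\mathrm{FU}(X)\in u$ and $X\subseteq^*\mathrm{FU}(X_n)$ for all $n$. The character of an ultrafilter is the least cardinality of a base for it. *)

theory Defs
  imports "HOL-Analysis.Analysis" "HOL-Library.Disjoint_Sets"
begin

unbundle cardinal_syntax

lemma Well_order_cardSuc_natLeq: "Well_order (cardSuc natLeq)"
  using cardSuc_Card_order[OF natLeq_Card_order] card_order_on_well_order_on by blast

lemma infinite_Field_cardSuc_natLeq: "infinite (Field (cardSuc natLeq))"
  using cardSuc_finite[OF natLeq_Card_order] by (simp add: Field_natLeq)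

typedef omega1 = "Field (cardSuc natLeq)"
  using infinite_Field_cardSuc_natLeq by (metis ex_in_conv finite.emptyI)

instantiation omega1 :: wellorder
begin

definition less_eq_omega1 :: "omega1 \<Rightarrow> omega1 \<Rightarrow> bool" where
  "(a :: omega1) \<le> b \<longleftrightarrow> (Rep_omega1 a, Rep_omega1 b) \<in> cardSuc natLeq"

definition less_omega1 :: "omega1 \<Rightarrow> omega1 \<Rightarrow> bool" where
  "(a :: omega1) < b \<longleftrightarrow> a \<le> b \<and> a \<noteq> b"

instance
proof
  have lin: "refl_on (Field (cardSuc natLeq)) (cardSuc natLeq)" "trans (cardSuc natLeq)"
    "antisym (cardSuc natLeq)" "total_on (Field (cardSuc natLeq)) (cardSuc natLeq)"
    and wf: "wf (cardSuc natLeq - Id)"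
    using Well_order_cardSuc_natLeq
    by (auto simp: well_order_on_def linear_order_on_def partial_order_on_def preorder_on_def)
  show refl: "x \<le> x" for x :: omega1
    using lin(1) Rep_omega1[of x] by (auto simp: less_eq_omega1_def refl_on_def)
  show "x \<le> z" if "x \<le> y" "y \<le> z" for x y z :: omega1
    using that lin(2) by (auto simp: less_eq_omega1_def elim: transE)
  show antisym: "x = y" if "x \<le> y" "y \<le> x" for x y :: omega1
    using that lin(3) by (auto simp: less_eq_omega1_def Rep_omega1_inject dest: antisymD)
  show "x < y \<longleftrightarrow> x \<le> y \<and> \<not> y \<le> x" for x y :: omega1
    using refl antisym by (auto simp: less_omega1_def)
  show "x \<le> y \<or> y \<le> x" for x y :: omega1
    using lin(4) Rep_omega1[of x] Rep_omega1[of y] refl[of x]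
    by (cases "x = y") (auto simp: less_eq_omega1_def total_on_def Rep_omega1_inject)
  show "P a" if step: "\<And>x. (\<And>y. y < x \<Longrightarrow> P y) \<Longrightarrow> P x" for P and a :: omega1
  proof -
    have "wf {(x, y). x < (y :: omega1)}"
      by (rule wf_subset[OF wf_inv_image[OF wf, of Rep_omega1]])
        (auto simp: less_omega1_def less_eq_omega1_def inv_image_def Rep_omega1_inject)
    then show ?thesis
      by (induction a rule: wf_induct_rule) (use step in auto)
  qed
qed

end

lemma card_of_UNIV_omega1: "|UNIV :: omega1 set| =o cardSuc natLeq"
proof -
  have "bij_betw Rep_omega1 UNIV (Field (cardSuc natLeq))"
    using type_definition.Rep_range[OF type_definition_omega1]
    by (auto simp: bij_betw_def inj_on_def Rep_omega1_inject)
  then have "|UNIV :: omega1 set| =o |Field (cardSuc natLeq)|"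
    using card_of_ordIso by blast
  then show ?thesis
    using card_of_Field_ordIso[OF cardSuc_Card_order[OF natLeq_Card_order]]
      ordIso_transitive by blast
qed

definition club :: "omega1 set \<Rightarrow> bool" where
  "club C \<longleftrightarrow>
     (\<forall>\<alpha>. \<exists>\<beta>\<in>C. \<alpha> < \<beta>) \<and>
     (\<forall>\<alpha>. (\<exists>\<beta>. \<beta> < \<alpha>) \<and> (\<forall>\<beta><\<alpha>. \<exists>\<gamma>\<in>C. \<beta> < \<gamma> \<and> \<gamma> < \<alpha>) \<longrightarrow> \<alpha> \<in> C)"

definition stationary :: "omega1 set \<Rightarrow> bool" where
  "stationary S \<longleftrightarrow> (\<forall>C. club C \<longrightarrow> S \<inter> C \<noteq> {})"

abbreviation fin_sets :: "nat set set" where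
  "fin_sets \<equiv> Fpow UNIV"

definition FU :: "nat set set \<Rightarrow> nat set set" where
  "FU X = {\<Union>F |F. F \<in> Fpow X - {{}}}"

text \<open>The maximum and minimum of a member of an ordered family are required to exist, so the empty
  set is not allowed as a member.\<close>

definition ordered_family :: "nat set set \<Rightarrow> bool" where
  "ordered_family X \<longleftrightarrow> X \<subseteq> fin_sets \<and> {} \<notin> X \<and>
     (\<forall>x\<in>X. \<forall>y\<in>X. x \<noteq> y \<longrightarrow> Max x < Min y \<or> Max y < Min x)"

definition pairwise_disjoint_family :: "nat set set \<Rightarrow> bool" where
  "pairwise_disjoint_family X \<longleftrightarrow> X \<subseteq> fin_sets \<and> disjoint X"

definition FU_reaped :: "nat set set \<Rightarrow> nat set set \<Rightarrow> bool" where
  "FU_reaped A X \<longleftrightarrow> FU X \<subseteq> A \<or> FU X \<inter> A = {}"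

text \<open>The space \<open>2\<^sup>I\<close>; its points are the functions on \<open>I\<close> that are \<open>undefined\<close> outside \<open>I\<close>.\<close>

definition cantor_space :: "'i set \<Rightarrow> ('i \<Rightarrow> bool) topology" where
  "cantor_space I = product_topology (\<lambda>_. discrete_topology UNIV) I"

definition borel_algebra :: "'a topology \<Rightarrow> 'a measure" where
  "borel_algebra T = sigma (topspace T) {U. openin T U}"

text \<open>A function on \<open>2\<^bsup><\<omega>\<^sub>1\<^esup>\<close>, the disjoint union of the levels \<open>2\<^sup>\<alpha>\<close>, is given by its
  restrictions \<open>F \<alpha>\<close> to the levels. The power set of \<open>fin_sets\<close> carries the topology of
  \<open>cantor_space fin_sets\<close> through characteristic functions.\<close>

definition borel_on_levels ::
    "(omega1 \<Rightarrow> (omega1 \<Rightarrow> bool) \<Rightarrow> nat set set) \<Rightarrow> bool" where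
  "borel_on_levels F \<longleftrightarrow>
     (\<forall>\<alpha>. F \<alpha> \<in> topspace (cantor_space {..<\<alpha>}) \<rightarrow> Pow fin_sets \<and>
          (\<lambda>s. \<lambda>x\<in>fin_sets. x \<in> F \<alpha> s)
            \<in> borel_algebra (cantor_space {..<\<alpha>}) \<rightarrow>\<^sub>M borel_algebra (cantor_space fin_sets))"

definition diamond_hom_H :: bool where
  "diamond_hom_H \<longleftrightarrow>
     (\<forall>F. borel_on_levels F \<longrightarrow>
       (\<exists>g :: omega1 \<Rightarrow> nat set set.
          (\<forall>\<alpha>. infinite (g \<alpha>) \<and> ordered_family (g \<alpha>)) \<and>
          (\<forall>f :: omega1 \<Rightarrow> bool. stationary {\<alpha>. FU_reaped (F \<alpha> (restrict f {..<\<alpha>})) (g \<alpha>)})))"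

definition ultrafilter_on :: "'a set \<Rightarrow> 'a set set \<Rightarrow> bool" where
  "ultrafilter_on S u \<longleftrightarrow>
     u \<subseteq> Pow S \<and> S \<in> u \<and> {} \<notin> u \<and>
     (\<forall>A\<in>u. \<forall>B\<in>u. A \<inter> B \<in> u) \<and>
     (\<forall>A\<in>u. \<forall>B. A \<subseteq> B \<and> B \<subseteq> S \<longrightarrow> B \<in> u) \<and>
     (\<forall>A. A \<subseteq> S \<longrightarrow> A \<in> u \<or> S - A \<in> u)"

definition union_ultrafilter :: "nat set set set \<Rightarrow> bool" where
  "union_ultrafilter u \<longleftrightarrow> ultrafilter_on fin_sets u \<and>
     (\<forall>A\<in>u. \<exists>X. infinite X \<and> pairwise_disjoint_family X \<and> FU X \<subseteq> A \<and> FU X \<in> u)"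

definition ordered_union_ultrafilter :: "nat set set set \<Rightarrow> bool" where
  "ordered_union_ultrafilter u \<longleftrightarrow> ultrafilter_on fin_sets u \<and>
     (\<forall>A\<in>u. \<exists>X. infinite X \<and> ordered_family X \<and> FU X \<subseteq> A \<and> FU X \<in> u)"

definition stable_union_ultrafilter :: "nat set set set \<Rightarrow> bool" where
  "stable_union_ultrafilter u \<longleftrightarrow> union_ultrafilter u \<and>
     (\<forall>Y :: nat \<Rightarrow> nat set set. (\<forall>n. pairwise_disjoint_family (Y n) \<and> FU (Y n) \<in> u) \<longrightarrow>
        (\<exists>X. pairwise_disjoint_family X \<and> FU X \<in> u \<and> (\<forall>n. finite (X - FU (Y n)))))"

definition filter_base :: "'a set set \<Rightarrow> 'a set set \<Rightarrow> bool" where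
  "filter_base u B \<longleftrightarrow> B \<subseteq> u \<and> (\<forall>A\<in>u. \<exists>b\<in>B. b \<subseteq> A)"

definition has_character :: "'a set set \<Rightarrow> 'c rel \<Rightarrow> bool" where
  "has_character u \<kappa> \<longleftrightarrow>
     (\<exists>B. filter_base u B \<and> |B| =o \<kappa>) \<and> (\<forall>B. filter_base u B \<longrightarrow> \<kappa> \<le>o |B| )"

end

theory Submission
  imports Defs "HOL-Library.Countable_Set_Type"
begin

text \<open>Block sequences \<open>X \<alpha>\<close>, \<open>\<alpha> < \<omega>\<^sub>1\<close>, are built by recursion so that \<open>X \<alpha>\<close> is almost
  contained in \<open>FU (X \<xi>)\<close> for all \<open>\<xi> < \<alpha>\<close>. At stage \<open>\<alpha>\<close> a block sequence
  \<open>y\<^sub>0 < y\<^sub>1 < \<dots>\<close> diagonalising the sets \<open>FU (X \<xi>)\<close>, \<open>\<xi> < \<alpha>\<close>, is chosen in a Borel way, and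
  \<open>X \<alpha>\<close> consists of the unions of the \<open>y\<^sub>i\<close> with \<open>i \<in> x\<close>, for \<open>x \<in> g \<alpha>\<close>. The diamond
  principle is applied to the Borel function that decodes a point of \<open>2\<^sup>\<alpha>\<close> into the sets
  \<open>FU (X \<xi>)\<close> and a set \<open>A\<close> and returns the set of all \<open>x\<close> for which the union of the \<open>y\<^sub>i\<close>
  with \<open>i \<in> x\<close> lies in \<open>A\<close>: whenever \<open>g \<alpha>\<close> reaps this set, \<open>X \<alpha>\<close> reaps \<open>A\<close>.
  The levels \<open>\<alpha>\<close> at which the coding is closed contain a club, so every \<open>A\<close> is reaped at
  some \<open>\<alpha>\<close>. A countable base is impossible, since any countably many infinite sets are split
  by a single set.\<close>

section \<open>The ordinal \<open>\<omega>\<^sub>1\<close>\<close>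

lemma countable_iff_ordLess_cardSuc_natLeq: "countable A \<longleftrightarrow> |A| <o cardSuc natLeq"
  unfolding countable_card_le_natLeq
  by (rule cardSuc_ordLeq_ordLess[OF natLeq_Card_order card_of_Card_order, symmetric])

lemma uncountable_iff_cardSuc_natLeq_ordLeq: "uncountable A \<longleftrightarrow> cardSuc natLeq \<le>o |A|"
  unfolding countable_iff_ordLess_cardSuc_natLeq
  by (rule not_ordLess_iff_ordLeq[OF Well_order_cardSuc_natLeq card_of_Well_order])

lemma card_of_Times_countable_ordLeq:
  assumes "infinite C" "|A| \<le>o |C|" "countable B"
  shows "|A \<times> B| \<le>o |C|"
proof -
  have "|B| \<le>o natLeq"
    using \<open>countable B\<close> by (simp add: countable_card_le_natLeq)
  also have "natLeq \<le>o |C|"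
    using \<open>infinite C\<close> infinite_iff_natLeq_ordLeq by blast
  finally show ?thesis
    using assms(1,2) by (simp add: card_of_Sigma_ordLeq_infinite)
qed

lemma uncountable_omega1: "uncountable (UNIV :: omega1 set)"
  using card_of_UNIV_omega1 by (simp add: uncountable_iff_cardSuc_natLeq_ordLeq ordIso_iff_ordLeq)

lemma countable_lessThan_omega1: "countable {..<\<alpha> :: omega1}"
proof -
  have "Rep_omega1 ` {..<\<alpha>} \<subseteq> underS (cardSuc natLeq) (Rep_omega1 \<alpha>)"
    by (auto simp: underS_def less_omega1_def less_eq_omega1_def Rep_omega1_inject)
  moreover have "countable (underS (cardSuc natLeq) (Rep_omega1 \<alpha>))"
    unfolding countable_iff_ordLess_cardSuc_natLeq
    by (rule card_of_underS[OF cardSuc_Card_order[OF natLeq_Card_order] Rep_omega1])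
  ultimately have "countable (Rep_omega1 ` {..<\<alpha>})"
    by (rule countable_subset)
  then show ?thesis
    by (rule countable_image_inj_on) (simp add: inj_on_def Rep_omega1_inject)
qed

lemma countable_omega1_bounded:
  assumes "countable (A :: omega1 set)"
  shows "\<exists>\<beta>. \<forall>\<alpha>\<in>A. \<alpha> < \<beta>"
proof (rule ccontr)
  assume "\<nexists>\<beta>. \<forall>\<alpha>\<in>A. \<alpha> < \<beta>"
  then have "UNIV = (\<Union>\<alpha>\<in>A. insert \<alpha> {..<\<alpha>})"
    by (auto simp: not_less) (metis le_less)
  moreover have "countable (\<Union>\<alpha>\<in>A. insert \<alpha> {..<\<alpha>})"
    using assms countable_lessThan_omega1 by auto
  ultimately show False
    using uncountable_omega1 by simp
qed

lemma ex_closed_point_above: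
  fixes f :: "omega1 \<Rightarrow> omega1"
  shows "\<exists>\<beta>>\<alpha>. \<forall>\<xi><\<beta>. f \<xi> < \<beta>"
proof -
  have "\<exists>\<gamma>. \<beta> < \<gamma> \<and> (\<forall>\<xi>\<le>\<beta>. f \<xi> < \<gamma>)" for \<beta>
  proof -
    have "countable (insert \<beta> (f ` insert \<beta> {..<\<beta>}))"
      using countable_lessThan_omega1 by simp
    from countable_omega1_bounded[OF this] show ?thesis
      by (auto simp: le_less)
  qed
  then obtain nxt where nxt: "\<And>\<beta>. \<beta> < nxt \<beta>" "\<And>\<beta> \<xi>. \<xi> \<le> \<beta> \<Longrightarrow> f \<xi> < nxt \<beta>"
    by metis
  define a where "a n = (nxt ^^ n) \<alpha>" for n
  define \<beta> where "\<beta> = (LEAST \<beta>. \<forall>n. a n < \<beta>)"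
  have "\<exists>\<beta>. \<forall>n. a n < \<beta>"
    using countable_omega1_bounded[of "range a"] by auto
  then have a_less: "a n < \<beta>" for n
    unfolding \<beta>_def using LeastI_ex[of "\<lambda>\<beta>. \<forall>n. a n < \<beta>"] by blast
  have "f \<xi> < \<beta>" if \<xi>: "\<xi> < \<beta>" for \<xi>
  proof -
    obtain n where "\<xi> \<le> a n"
      using not_less_Least[of \<xi> "\<lambda>\<beta>. \<forall>n. a n < \<beta>"] \<xi> unfolding \<beta>_def by (meson not_le)
    then have "f \<xi> < a (Suc n)"
      using nxt(2) by (simp add: a_def)
    then show ?thesis
      using a_less by (rule order.strict_trans)
  qed
  moreover have "\<alpha> < \<beta>"
    using a_less[of 0] by (simp add: a_def)
  ultimately show ?thesis
    by blast
qed

lemma club_closed_points: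
  fixes f :: "omega1 \<Rightarrow> omega1"
  shows "club {\<alpha>. \<gamma> < \<alpha> \<and> (\<forall>\<xi><\<alpha>. f \<xi> < \<alpha>)}" (is "club ?C")
  unfolding club_def
proof (intro conjI allI impI; (elim conjE exE)?)
  fix \<alpha>
  show "\<exists>\<beta>\<in>?C. \<alpha> < \<beta>"
    using ex_closed_point_above[of "max \<alpha> \<gamma>" f] by auto
next
  fix \<alpha> \<beta>
  assume "\<beta> < \<alpha>" and limit: "\<forall>\<beta><\<alpha>. \<exists>\<delta>\<in>?C. \<beta> < \<delta> \<and> \<delta> < \<alpha>"
  have "f \<xi> < \<alpha>" if \<xi>: "\<xi> < \<alpha>" for \<xi>
  proof -
    obtain \<delta> where "\<delta> \<in> ?C" "\<xi> < \<delta>" "\<delta> < \<alpha>"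
      using limit \<xi> by blast
    then show ?thesis
      by (auto intro: order.strict_trans)
  qed
  moreover have "\<gamma> < \<alpha>"
    using limit \<open>\<beta> < \<alpha>\<close> by (auto intro: order.strict_trans)
  ultimately show "\<alpha> \<in> ?C"
    by simp
qed

section \<open>Measurability\<close>

lemma topspace_cantor_space: "topspace (cantor_space I) = (\<Pi>\<^sub>E i\<in>I. UNIV)"
  by (simp add: cantor_space_def)

lemma space_borel_algebra: "space (borel_algebra T) = topspace T"
  by (simp add: borel_algebra_def space_measure_of_conv)

lemma sets_borel_algebra: "sets (borel_algebra T) = sigma_sets (topspace T) {U. openin T U}"
  unfolding borel_algebra_def by (rule sets_measure_of) (auto dest: openin_subset)

lemma pred_cantor_space_component:
  assumes "i \<in> I"
  shows "Measurable.pred (borel_algebra (cantor_space I)) (\<lambda>s. s i)"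
proof -
  have "openin (cantor_space I) {s \<in> topspace (cantor_space I). s i \<in> {True}}"
    unfolding cantor_space_def
    by (rule openin_continuous_map_preimage[OF continuous_map_product_projection[OF assms]]) simp
  then show ?thesis
    by (auto simp: pred_def sets_borel_algebra space_borel_algebra)
qed

lemma openin_countable_subbase:
  assumes subbase: "openin T = arbitrary union_of (finite intersection_of S relative_to topspace T)"
    and "countable (Collect S)" and "openin T U"
  obtains \<F> where "countable \<F>" "\<F> \<subseteq> Fpow (Collect S)" "U = (\<Union>F\<in>\<F>. topspace T \<inter> \<Inter>F)"
proof
  define \<F> where "\<F> = {F \<in> Fpow (Collect S). topspace T \<inter> \<Inter>F \<subseteq> U}"
  show "\<F> \<subseteq> Fpow (Collect S)"
    by (auto simp: \<F>_def)
  then show "countable \<F>"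
    by (rule countable_subset) (rule countable_Fpow[OF assms(2)])
  have base: "\<forall>x\<in>U. \<exists>V. (finite intersection_of S relative_to topspace T) V \<and> x \<in> V \<and> V \<subseteq> U"
    using assms(3) by (simp only: subbase arbitrary_union_of_alt)
  have "U \<subseteq> (\<Union>F\<in>\<F>. topspace T \<inter> \<Inter>F)"
  proof
    fix x assume x: "x \<in> U"
    obtain V where "(finite intersection_of S relative_to topspace T) V" "x \<in> V" "V \<subseteq> U"
      using base x by blast
    then obtain F where F: "finite F" "F \<subseteq> Collect S" "V = topspace T \<inter> \<Inter>F"
      unfolding relative_to_def intersection_of_def by blast
    with \<open>V \<subseteq> U\<close> have "F \<in> \<F>"
      by (simp add: \<F>_def Fpow_def)
    then show "x \<in> (\<Union>F\<in>\<F>. topspace T \<inter> \<Inter>F)"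
      by (rule UN_I) (use F(3) \<open>x \<in> V\<close> in simp)
  qed
  moreover have "(\<Union>F\<in>\<F>. topspace T \<inter> \<Inter>F) \<subseteq> U"
    by (rule UN_least) (simp add: \<F>_def)
  ultimately show "U = (\<Union>F\<in>\<F>. topspace T \<inter> \<Inter>F)"
    by (rule equalityI)
qed

lemma measurable_countable_subbase:
  assumes subbase: "openin T = arbitrary union_of (finite intersection_of S relative_to topspace T)"
    and "countable (Collect S)" and f: "f \<in> space M \<rightarrow> topspace T"
    and pred: "\<And>A. S A \<Longrightarrow> Measurable.pred M (\<lambda>s. f s \<in> A)"
  shows "f \<in> M \<rightarrow>\<^sub>M borel_algebra T"
proof (rule measurable_sigma_sets[OF sets_borel_algebra _ f])
  show "{U. openin T U} \<subseteq> Pow (topspace T)"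
    by (auto dest: openin_subset)
  fix U assume "U \<in> {U. openin T U}"
  then have "openin T U"
    by simp
  then obtain \<F> where \<F>: "countable \<F>" "\<F> \<subseteq> Fpow (Collect S)"
    and U: "U = (\<Union>F\<in>\<F>. topspace T \<inter> \<Inter>F)"
    by (rule openin_countable_subbase[OF subbase assms(2)])
  have "f -` U \<inter> space M = (\<Union>F\<in>\<F>. {s \<in> space M. \<forall>A\<in>F. f s \<in> A})"
    using f unfolding U by auto
  also have "\<dots> \<in> sets M"
  proof (intro sets.countable_UN'' \<F>(1))
    fix F assume "F \<in> \<F>"
    then have "finite F" "F \<subseteq> Collect S"
      using \<F>(2) by (auto simp: Fpow_def)
    then have "Measurable.pred M (\<lambda>s. \<forall>A\<in>F. f s \<in> A)"
      using pred by (intro pred_intros_finite(3)) auto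
    then show "{s \<in> space M. \<forall>A\<in>F. f s \<in> A} \<in> sets M"
      by (simp add: pred_def)
  qed
  finally show "f -` U \<inter> space M \<in> sets M" .
qed

lemma measurable_into_cantor_space:
  assumes "countable I" "f \<in> space M \<rightarrow> topspace (cantor_space I)"
    and comp: "\<And>i. i \<in> I \<Longrightarrow> Measurable.pred M (\<lambda>s. f s i)"
  shows "f \<in> M \<rightarrow>\<^sub>M borel_algebra (cantor_space I)"
proof (rule measurable_countable_subbase[OF _ _ assms(2)])
  define S where "S F \<longleftrightarrow> (\<exists>i V. F = {h. h i \<in> V} \<and> i \<in> I \<and> openin (discrete_topology UNIV) V)"
    for F :: "('a \<Rightarrow> bool) set"
  show "openin (cantor_space I)
      = arbitrary union_of (finite intersection_of S relative_to topspace (cantor_space I))"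
    unfolding cantor_space_def openin_product_topology S_def ..
  have "Collect S \<subseteq> (\<lambda>(i, V). {h. h i \<in> V}) ` (I \<times> UNIV)"
    unfolding S_def by blast
  then show "countable (Collect S)"
    by (rule countable_subset) (simp add: \<open>countable I\<close>)
  fix A assume "S A"
  then obtain i V where A: "A = {h. h i \<in> V}" and "i \<in> I"
    by (auto simp: S_def)
  show "Measurable.pred M (\<lambda>s. f s \<in> A)"
    unfolding A mem_Collect_eq by (rule measurable_compose[OF comp[OF \<open>i \<in> I\<close>]]) simp
qed

definition setwise_measurable :: "'s measure \<Rightarrow> ('s \<Rightarrow> nat set set) \<Rightarrow> bool" where
  "setwise_measurable M A \<longleftrightarrow> (\<forall>z\<in>fin_sets. Measurable.pred M (\<lambda>s. z \<in> A s))"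

lemma countable_fin_sets: "countable fin_sets"
  by (simp add: countable_Fpow)

lemma setwise_measurable_INT:
  assumes "finite I" "\<And>i. i \<in> I \<Longrightarrow> setwise_measurable M (\<lambda>s. A s i)"
  shows "setwise_measurable M (\<lambda>s. \<Inter>i\<in>I. A s i)"
  using assms by (auto simp: setwise_measurable_def intro!: pred_intros_finite(3))

lemma pred_in_setwise_measurable:
  assumes "setwise_measurable M A" "f \<in> M \<rightarrow>\<^sub>M count_space fin_sets"
  shows "Measurable.pred M (\<lambda>s. f s \<in> A s)"
  by (rule measurable_compose_countable'[OF _ assms(2) countable_fin_sets])
    (use assms(1) in \<open>simp add: setwise_measurable_def\<close>)

section \<open>Finite unions and ordered families\<close>

definition block_less :: "nat set \<Rightarrow> nat set \<Rightarrow> bool" (infix "\<lless>" 50) where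
  "x \<lless> y \<longleftrightarrow> (\<forall>a\<in>x. \<forall>b\<in>y. a < b)"

lemma block_less_irrefl: "x \<lless> x \<longleftrightarrow> x = {}"
  by (auto simp: block_less_def)

lemma block_less_trans: "x \<lless> y \<Longrightarrow> y \<lless> z \<Longrightarrow> y \<noteq> {} \<Longrightarrow> x \<lless> z"
  by (force simp: block_less_def)

lemma block_less_Un_left: "x \<union> y \<lless> z \<longleftrightarrow> x \<lless> z \<and> y \<lless> z"
  by (auto simp: block_less_def)

lemma block_less_Un_right: "x \<lless> y \<union> z \<longleftrightarrow> x \<lless> y \<and> x \<lless> z"
  by (auto simp: block_less_def)

lemma Max_less_Min_iff_block_less:
  assumes "finite x" "x \<noteq> {}" "finite y" "y \<noteq> {}"
  shows "Max x < Min y \<longleftrightarrow> x \<lless> y"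
  using assms by (auto simp: block_less_def)

lemma ordered_family_iff:
  "ordered_family X \<longleftrightarrow> X \<subseteq> fin_sets \<and> {} \<notin> X \<and> (\<forall>x\<in>X. \<forall>y\<in>X. x \<noteq> y \<longrightarrow> x \<lless> y \<or> y \<lless> x)"
proof -
  have "Max x < Min y \<longleftrightarrow> x \<lless> y" if "X \<subseteq> fin_sets" "{} \<notin> X" "x \<in> X" "y \<in> X" for x y
    using that by (intro Max_less_Min_iff_block_less) (auto simp: Fpow_def)
  then show ?thesis
    unfolding ordered_family_def by (intro conj_cong ball_cong imp_cong disj_cong refl) auto
qed

lemma ordered_family_mem:
  assumes "ordered_family X" "x \<in> X"
  shows "finite x" "x \<noteq> {}"
  using assms by (auto simp: ordered_family_def Fpow_def)

lemma ordered_family_subset: "ordered_family X \<Longrightarrow> Y \<subseteq> X \<Longrightarrow> ordered_family Y"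
  unfolding ordered_family_def by (meson order_trans subsetD)

lemma ordered_family_imp_disjoint:
  assumes "ordered_family X"
  shows "disjoint X"
proof (rule disjointI)
  fix x y assume "x \<in> X" "y \<in> X" "x \<noteq> y"
  then have "x \<lless> y \<or> y \<lless> x"
    using assms by (auto simp: ordered_family_iff)
  then show "x \<inter> y = {}"
    by (auto simp: block_less_def)
qed

lemma ordered_family_imp_pairwise_disjoint_family:
  "ordered_family X \<Longrightarrow> pairwise_disjoint_family X"
  by (simp add: pairwise_disjoint_family_def ordered_family_imp_disjoint ordered_family_def)

lemma FU_iff: "z \<in> FU X \<longleftrightarrow> (\<exists>F. finite F \<and> F \<noteq> {} \<and> F \<subseteq> X \<and> z = \<Union>F)"
  by (auto simp: FU_def Fpow_def)

lemma subset_FU: "X \<subseteq> FU X"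
proof
  fix x assume "x \<in> X"
  then show "x \<in> FU X"
    unfolding FU_iff by (intro exI[of _ "{x}"]) simp
qed

lemma FU_Un:
  assumes "z \<in> FU X" "w \<in> FU X"
  shows "z \<union> w \<in> FU X"
proof -
  obtain F where "finite F" "F \<noteq> {}" "F \<subseteq> X" "z = \<Union>F"
    using assms(1) unfolding FU_iff by metis
  moreover obtain G where "finite G" "G \<subseteq> X" "w = \<Union>G"
    using assms(2) unfolding FU_iff by metis
  ultimately show ?thesis
    unfolding FU_iff by (intro exI[of _ "F \<union> G"]) simp
qed

lemma FU_Union:
  assumes "finite F" "F \<noteq> {}" "F \<subseteq> FU X"
  shows "\<Union>F \<in> FU X"
  using assms by (induction F rule: finite_ne_induct) (auto intro: FU_Un)

lemma FU_least:
  assumes "X \<subseteq> C" and Un: "\<And>x y. x \<in> C \<Longrightarrow> y \<in> C \<Longrightarrow> x \<union> y \<in> C"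
  shows "FU X \<subseteq> C"
proof
  fix z assume "z \<in> FU X"
  then obtain F where "finite F" "F \<noteq> {}" "F \<subseteq> X" and z: "z = \<Union>F"
    unfolding FU_iff by metis
  moreover from \<open>F \<subseteq> X\<close> have "F \<subseteq> C"
    using assms(1) by (rule order_trans)
  ultimately show "z \<in> C"
    unfolding z by (induction F rule: finite_ne_induct) (auto intro: Un)
qed

lemma FU_subset_FU: "X \<subseteq> FU Y \<Longrightarrow> FU X \<subseteq> FU Y"
  by (rule FU_least) (auto intro: FU_Un)

lemma FU_subset_fin_sets: "X \<subseteq> fin_sets \<Longrightarrow> FU X \<subseteq> fin_sets"
  by (rule FU_least) (auto simp: Fpow_def)

lemma FU_image:
  assumes h: "\<And>x y. h (x \<union> y) = h x \<union> h y"
  shows "FU (h ` X) = h ` FU X"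
proof
  show "FU (h ` X) \<subseteq> h ` FU X"
    by (rule FU_least) (use subset_FU FU_Un in \<open>auto simp: h[symmetric]\<close>)
  have "FU X \<subseteq> h -` FU (h ` X)"
    by (rule FU_least) (use subset_FU[of "h ` X"] FU_Un in \<open>auto simp: h\<close>)
  then show "h ` FU X \<subseteq> FU (h ` X)"
    by blast
qed

definition tail :: "nat set \<Rightarrow> nat set set \<Rightarrow> nat set set" where
  "tail p X = {x \<in> X. p \<lless> x}"

lemma tail_subset: "tail p X \<subseteq> X"
  by (auto simp: tail_def)

lemma tail_empty: "tail {} X = X"
  by (auto simp: tail_def block_less_def)

lemma FU_tail: "FU (tail p X) = tail p (FU X)"
proof
  show "FU (tail p X) \<subseteq> tail p (FU X)"
    by (rule FU_least) (use subset_FU FU_Un in \<open>auto simp: tail_def block_less_Un_right\<close>)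
  have "FU X \<subseteq> {z. p \<lless> z \<longrightarrow> z \<in> FU (tail p X)}"
    by (rule FU_least)
      (use subset_FU[of "tail p X"] FU_Un in \<open>auto simp: tail_def block_less_Un_right\<close>)
  then show "tail p (FU X) \<subseteq> FU (tail p X)"
    by (auto simp: tail_def)
qed

lemma FU_tail_Un: "FU (tail (p \<union> q) X) = FU (tail p X) \<inter> FU (tail q X)"
  unfolding FU_tail by (auto simp: tail_def block_less_Un_left)

lemma finite_Diff_tail:
  assumes "ordered_family X" "finite p"
  shows "finite (X - tail p X)"
proof -
  obtain m where m: "p \<subseteq> {..m}"
    using \<open>finite p\<close> finite_nat_iff_bounded_le by blast
  define trace where "trace x = x \<inter> {..m}" for x
  have nonempty: "trace x \<noteq> {}" if x: "x \<in> X - tail p X" for x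
  proof -
    obtain a b where "a \<in> p" "b \<in> x" "b \<le> a"
      using x by (auto simp: tail_def block_less_def not_less)
    then show ?thesis
      using m by (fastforce simp: trace_def)
  qed
  have "inj_on trace (X - tail p X)"
  proof (rule inj_onI, rule ccontr)
    fix x y assume xy: "x \<in> X - tail p X" "y \<in> X - tail p X" "trace x = trace y" "x \<noteq> y"
    then have "x \<inter> y = {}"
      using ordered_family_imp_disjoint[OF assms(1)] by (auto dest: disjointD)
    then show False
      using nonempty[OF xy(1)] xy(3) by (auto simp: trace_def)
  qed
  moreover have "trace ` (X - tail p X) \<subseteq> Pow {..m}"
    by (auto simp: trace_def)
  ultimately show ?thesis
    by (rule inj_on_finite) simp
qed

section \<open>Block families and almost inclusion\<close>

definition block_family :: "nat set set \<Rightarrow> bool" where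
  "block_family X \<longleftrightarrow> infinite X \<and> ordered_family X"

definition almost_subset :: "'a set \<Rightarrow> 'a set \<Rightarrow> bool" (infix "\<subseteq>\<^sup>*" 50) where
  "X \<subseteq>\<^sup>* Y \<longleftrightarrow> finite (X - Y)"

lemma subset_imp_almost_subset: "X \<subseteq> Y \<Longrightarrow> X \<subseteq>\<^sup>* Y"
  unfolding almost_subset_def by (metis Diff_eq_empty_iff finite.emptyI)

lemma almost_subset_INT:
  assumes "finite I" "\<And>i. i \<in> I \<Longrightarrow> X \<subseteq>\<^sup>* Y i"
  shows "X \<subseteq>\<^sup>* (\<Inter>i\<in>I. Y i)"
proof -
  have "X - (\<Inter>i\<in>I. Y i) = (\<Union>i\<in>I. X - Y i)"
    by blast
  also have "finite \<dots>"
    using assms by (intro finite_UN_I) (simp_all add: almost_subset_def)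
  finally show ?thesis
    by (simp only: almost_subset_def)
qed

lemma block_family_tail:
  assumes "block_family X" "finite p"
  shows "block_family (tail p X)"
proof -
  have "infinite (X - (X - tail p X))"
    using assms by (intro Diff_infinite_finite finite_Diff_tail) (auto simp: block_family_def)
  moreover have "X - (X - tail p X) = tail p X"
    using tail_subset by blast
  ultimately show ?thesis
    using assms(1) ordered_family_subset[OF _ tail_subset] by (simp add: block_family_def)
qed

lemma tail_subset_imp_almost_subset:
  assumes "ordered_family X" "finite p" "tail p X \<subseteq> Y"
  shows "X \<subseteq>\<^sup>* Y"
  unfolding almost_subset_def
  by (rule finite_subset[OF _ finite_Diff_tail[OF assms(1,2)]]) (use assms(3) in blast)

lemma almost_subset_imp_FU_tail_subset:
  assumes X: "ordered_family X" and "X \<subseteq>\<^sup>* FU Y" "finite p"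
  shows "\<exists>q. finite q \<and> FU (tail q X) \<subseteq> FU (tail p Y)"
proof (intro exI conjI)
  define q where "q = p \<union> \<Union>(X - FU Y)"
  show "finite q"
    using assms by (auto simp: q_def almost_subset_def ordered_family_mem)
  have "tail q X \<subseteq> FU (tail p Y)"
  proof
    fix x assume "x \<in> tail q X"
    then have x: "x \<in> X" "p \<lless> x" "\<Union>(X - FU Y) \<lless> x"
      by (auto simp: tail_def q_def block_less_Un_left)
    have "x \<in> FU Y"
    proof (rule ccontr)
      assume "x \<notin> FU Y"
      then have "x \<lless> x"
        using x(1,3) by (auto simp: block_less_def)
      then show False
        using ordered_family_mem(2)[OF X x(1)] by (simp add: block_less_irrefl)
    qed
    then show "x \<in> FU (tail p Y)"
      unfolding FU_tail using x(2) by (simp add: tail_def)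
  qed
  then show "FU (tail q X) \<subseteq> FU (tail p Y)"
    by (rule FU_subset_FU)
qed

definition cofinal_blocks :: "nat set set \<Rightarrow> bool" where
  "cofinal_blocks A \<longleftrightarrow> (\<forall>p. finite p \<longrightarrow> (\<exists>x\<in>A. finite x \<and> x \<noteq> {} \<and> p \<lless> x))"

lemma cofinal_blocks_UNIV: "cofinal_blocks UNIV"
  unfolding cofinal_blocks_def
proof (intro allI impI)
  fix p :: "nat set" assume "finite p"
  then obtain m where "\<forall>a\<in>p. a < m"
    using finite_nat_set_iff_bounded by blast
  then show "\<exists>x\<in>UNIV. finite x \<and> x \<noteq> {} \<and> p \<lless> x"
    by (intro bexI[of _ "{m}"]) (auto simp: block_less_def)
qed

lemma block_family_imp_cofinal_blocks:
  assumes "block_family X" "X \<subseteq>\<^sup>* A"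
  shows "cofinal_blocks A"
  unfolding cofinal_blocks_def
proof (intro allI impI)
  fix p :: "nat set" assume "finite p"
  then have "infinite (tail p X - (X - A))"
    using assms block_family_tail
    by (intro Diff_infinite_finite) (auto simp: block_family_def almost_subset_def)
  then have "tail p X - (X - A) \<noteq> {}"
    by (rule infinite_imp_nonempty)
  then obtain x where "x \<in> tail p X" "x \<in> A"
    by (auto simp: tail_def)
  moreover from this have "finite x" "x \<noteq> {}"
    using assms(1) ordered_family_mem by (auto simp: block_family_def tail_def)
  ultimately show "\<exists>x\<in>A. finite x \<and> x \<noteq> {} \<and> p \<lless> x"
    by (auto simp: tail_def)
qed

lemma cofinal_blocks_INT_FU:
  fixes X :: "'i::linorder \<Rightarrow> nat set set"
  assumes "finite F" and block: "\<And>\<xi>. \<xi> \<in> F \<Longrightarrow> block_family (X \<xi>)"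
    and decr: "\<And>\<xi> \<eta>. \<xi> \<in> F \<Longrightarrow> \<eta> \<in> F \<Longrightarrow> \<eta> < \<xi> \<Longrightarrow> X \<xi> \<subseteq>\<^sup>* FU (X \<eta>)"
  shows "cofinal_blocks (\<Inter>\<xi>\<in>F. FU (X \<xi>))"
proof (cases "F = {}")
  case True
  then show ?thesis
    by (simp add: cofinal_blocks_UNIV)
next
  case False
  define \<xi> where "\<xi> = Max F"
  have "\<xi> \<in> F"
    using False \<open>finite F\<close> by (simp add: \<xi>_def)
  have "X \<xi> \<subseteq>\<^sup>* FU (X \<eta>)" if "\<eta> \<in> F" for \<eta>
  proof (cases "\<eta> = \<xi>")
    case True
    then show ?thesis
      by (simp add: subset_FU subset_imp_almost_subset)
  next
    case False
    then have "\<eta> < \<xi>"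
      using that \<open>finite F\<close> by (simp add: \<xi>_def le_neq_trans)
    then show ?thesis
      by (rule decr[OF \<open>\<xi> \<in> F\<close> that])
  qed
  then have "X \<xi> \<subseteq>\<^sup>* (\<Inter>\<eta>\<in>F. FU (X \<eta>))"
    by (rule almost_subset_INT[OF \<open>finite F\<close>])
  then show ?thesis
    by (rule block_family_imp_cofinal_blocks[OF block[OF \<open>\<xi> \<in> F\<close>]])
qed

section \<open>Unions along a block sequence\<close>

definition block_seq :: "(nat \<Rightarrow> nat set) \<Rightarrow> bool" where
  "block_seq y \<longleftrightarrow> (\<forall>n. finite (y n) \<and> y n \<noteq> {}) \<and> (\<forall>m n. m < n \<longrightarrow> y m \<lless> y n)"

lemma block_seqI:
  assumes "\<And>n. finite (y n)" "\<And>n. y n \<noteq> {}" "\<And>n. y n \<lless> y (Suc n)"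
  shows "block_seq y"
proof -
  have "y m \<lless> y n" if "m < n" for m n
    using that
    by (induction m n rule: less_Suc_induct) (fact assms(3), rule block_less_trans[OF _ _ assms(2)])
  then show ?thesis
    using assms(1,2) by (simp add: block_seq_def)
qed

definition block_union :: "(nat \<Rightarrow> nat set) \<Rightarrow> nat set \<Rightarrow> nat set" where
  "block_union y x = \<Union>(y ` x)"

lemma block_union_Un: "block_union y (x \<union> z) = block_union y x \<union> block_union y z"
  by (auto simp: block_union_def)

lemma block_union_in_fin_sets:
  assumes "block_seq y" "finite x"
  shows "block_union y x \<in> fin_sets"
  using assms by (auto simp: block_union_def block_seq_def Fpow_def)

lemma block_union_nonempty:
  assumes "block_seq y" "x \<noteq> {}"
  shows "block_union y x \<noteq> {}"
  using assms by (auto simp: block_union_def block_seq_def)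

lemma block_less_block_union:
  assumes "block_seq y" "p \<lless> q"
  shows "block_union y p \<lless> block_union y q"
  using assms by (fastforce simp: block_union_def block_seq_def block_less_def)

lemma inj_on_block_union:
  assumes y: "block_seq y" and G: "ordered_family G"
  shows "inj_on (block_union y) G"
proof (rule inj_onI, rule ccontr)
  fix p q assume pq: "p \<in> G" "q \<in> G" "block_union y p = block_union y q" "p \<noteq> q"
  then have "p \<lless> q \<or> q \<lless> p"
    using G by (auto simp: ordered_family_iff)
  then have "block_union y p \<lless> block_union y p"
    using block_less_block_union[OF y] pq(3) by metis
  moreover have "block_union y p \<noteq> {}"
    by (rule block_union_nonempty[OF y ordered_family_mem(2)[OF G pq(1)]])
  ultimately show False
    by (simp add: block_less_irrefl)
qed

lemma ordered_family_image_block_union: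
  assumes y: "block_seq y" and G: "ordered_family G"
  shows "ordered_family (block_union y ` G)"
  unfolding ordered_family_iff
proof (intro conjI ballI impI)
  show "block_union y ` G \<subseteq> fin_sets"
    using block_union_in_fin_sets[OF y] ordered_family_mem(1)[OF G] by blast
  show "{} \<notin> block_union y ` G"
    using block_union_nonempty[OF y ordered_family_mem(2)[OF G]] by (metis imageE)
  fix u v assume "u \<in> block_union y ` G" "v \<in> block_union y ` G" "u \<noteq> v"
  then obtain p q where "p \<in> G" "q \<in> G" "p \<noteq> q" and uv: "u = block_union y p" "v = block_union y q"
    by blast
  then have "p \<lless> q \<or> q \<lless> p"
    using G by (auto simp: ordered_family_iff)
  then show "u \<lless> v \<or> v \<lless> u"
    unfolding uv using block_less_block_union[OF y] by blast
qed

lemma block_family_image_block_union: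
  assumes "block_seq y" "block_family G"
  shows "block_family (block_union y ` G)"
  using assms
  by (simp add: block_family_def finite_image_iff inj_on_block_union
      ordered_family_image_block_union)

lemma almost_subset_image_block_union:
  assumes "ordered_family G" and y: "\<And>n. j \<le> n \<Longrightarrow> y n \<in> FU Y"
  shows "block_union y ` G \<subseteq>\<^sup>* FU Y"
proof -
  have "block_union y x \<in> FU Y" if x: "x \<in> tail {..<j} G" for x
    unfolding block_union_def
  proof (rule FU_Union)
    show "finite (y ` x)" "y ` x \<noteq> {}"
      using x ordered_family_mem[OF assms(1)] by (auto simp: tail_def)
    have "j \<le> i" if "i \<in> x" for i
      by (rule leI) (use x that in \<open>auto simp: tail_def block_less_def\<close>)
    then show "y ` x \<subseteq> FU Y"
      using y by blast
  qed
  then have "block_union y ` G - FU Y \<subseteq> block_union y ` (G - tail {..<j} G)"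
    by blast
  then show ?thesis
    unfolding almost_subset_def
    by (rule finite_subset) (intro finite_imageI finite_Diff_tail assms(1) finite_lessThan)
qed

lemma FU_reaped_image_block_union:
  assumes "G \<subseteq> fin_sets"
  shows "FU_reaped A (block_union y ` G) \<longleftrightarrow> FU_reaped {x \<in> fin_sets. block_union y x \<in> A} G"
  using FU_subset_fin_sets[OF assms]
  unfolding FU_reaped_def FU_image[of "block_union y", OF block_union_Un] by blast

lemma measurable_block_union:
  assumes "finite x" and y: "\<And>i. (\<lambda>s. y s i) \<in> M \<rightarrow>\<^sub>M count_space fin_sets"
  shows "(\<lambda>s. block_union (y s) x) \<in> M \<rightarrow>\<^sub>M count_space fin_sets"
  using assms(1)
proof (induction x)
  case empty
  show ?case
    by (simp add: block_union_def Fpow_def)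
next
  case (insert i x)
  have "(\<lambda>s. y s i \<union> block_union (y s) x) \<in> M \<rightarrow>\<^sub>M count_space fin_sets"
  proof (rule measurable_compose_countable'[OF _ y countable_fin_sets])
    fix z :: "nat set" assume "z \<in> fin_sets"
    then have "(\<union>) z \<in> count_space fin_sets \<rightarrow>\<^sub>M count_space fin_sets"
      by (auto simp: Fpow_def)
    from measurable_compose[OF insert.IH this]
    show "(\<lambda>s. z \<union> block_union (y s) x) \<in> M \<rightarrow>\<^sub>M count_space fin_sets" .
  qed
  then show ?case
    by (simp add: block_union_def)
qed

section \<open>Diagonal block sequences\<close>

text \<open>Choosing the block with the least code, rather than an arbitrary one, is what makes the
  diagonal sequence a Borel function of the sets it diagonalises.\<close>

definition next_block :: "nat set \<Rightarrow> nat set set \<Rightarrow> nat set" where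
  "next_block p A =
     set_decode (LEAST k. set_decode k \<noteq> {} \<and> p \<lless> set_decode k \<and> set_decode k \<in> A)"

lemma finite_next_block: "finite (next_block p A)"
  by (simp add: next_block_def)

lemma
  assumes "cofinal_blocks A" "finite p"
  shows next_block_nonempty: "next_block p A \<noteq> {}"
    and block_less_next_block: "p \<lless> next_block p A"
    and next_block_in: "next_block p A \<in> A"
proof -
  obtain x where "x \<in> A" "finite x" "x \<noteq> {}" "p \<lless> x"
    using assms by (auto simp: cofinal_blocks_def)
  then have "\<exists>k. set_decode k \<noteq> {} \<and> p \<lless> set_decode k \<and> set_decode k \<in> A"
    by (metis set_encode_inverse)
  from LeastI_ex[OF this]
  show "next_block p A \<noteq> {}" "p \<lless> next_block p A" "next_block p A \<in> A"
    by (auto simp: next_block_def)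
qed

lemma measurable_next_block:
  assumes "setwise_measurable M A"
  shows "(\<lambda>s. next_block p (A s)) \<in> M \<rightarrow>\<^sub>M count_space fin_sets"
proof -
  have "Measurable.pred M (\<lambda>s. set_decode k \<in> A s)" for k
    using assms by (simp add: setwise_measurable_def Fpow_def)
  then have "(\<lambda>s. LEAST k. set_decode k \<noteq> {} \<and> p \<lless> set_decode k \<and> set_decode k \<in> A s)
      \<in> M \<rightarrow>\<^sub>M count_space UNIV"
    by (intro measurable_Least pred_intros_logic) auto
  moreover have "set_decode \<in> count_space UNIV \<rightarrow>\<^sub>M count_space fin_sets"
    by (simp add: Fpow_def)
  ultimately show ?thesis
    unfolding next_block_def by (rule measurable_compose)
qed

primrec greedy_seq :: "(nat \<Rightarrow> nat set set) \<Rightarrow> nat \<Rightarrow> nat set" where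
  "greedy_seq W 0 = next_block {} (W 0)"
| "greedy_seq W (Suc n) = next_block (greedy_seq W n) (W (Suc n))"

lemma finite_greedy_seq: "finite (greedy_seq W n)"
  by (cases n) (simp_all add: finite_next_block)

lemma greedy_seq_in:
  assumes "\<And>n. cofinal_blocks (W n)"
  shows "greedy_seq W n \<in> W n"
  using assms by (cases n) (simp_all add: next_block_in finite_greedy_seq)

lemma block_seq_greedy_seq:
  assumes "\<And>n. cofinal_blocks (W n)"
  shows "block_seq (greedy_seq W)"
proof (rule block_seqI)
  show "greedy_seq W n \<noteq> {}" for n
    using assms by (cases n) (simp_all add: next_block_nonempty finite_greedy_seq)
  show "greedy_seq W n \<lless> greedy_seq W (Suc n)" for n
    using assms by (simp add: block_less_next_block finite_greedy_seq)
qed (rule finite_greedy_seq)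

lemma measurable_greedy_seq:
  assumes "\<And>n. setwise_measurable M (\<lambda>s. W s n)"
  shows "(\<lambda>s. greedy_seq (W s) n) \<in> M \<rightarrow>\<^sub>M count_space fin_sets"
proof (induction n)
  case 0
  show ?case
    by (simp add: measurable_next_block assms)
next
  case (Suc n)
  show ?case
    unfolding greedy_seq.simps
    by (rule measurable_compose_countable'[OF _ Suc countable_fin_sets])
      (rule measurable_next_block[OF assms])
qed

definition diag_seq :: "'i set \<Rightarrow> ('i \<Rightarrow> nat set set) \<Rightarrow> nat \<Rightarrow> nat set" where
  "diag_seq I Z = greedy_seq (\<lambda>n. \<Inter>i\<in>{i \<in> I. to_nat_on I i \<le> n}. Z i)"

lemma diag_seq_cong [fundef_cong]:
  assumes "I = I'" "\<And>i. i \<in> I' \<Longrightarrow> Z i = Z' i"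
  shows "diag_seq I Z = diag_seq I' Z'"
  using assms by (simp add: diag_seq_def)

lemma finite_to_nat_on_le:
  assumes "countable I"
  shows "finite {i \<in> I. to_nat_on I i \<le> n}"
proof (rule inj_on_finite)
  show "inj_on (to_nat_on I) {i \<in> I. to_nat_on I i \<le> n}"
    using inj_on_to_nat_on[OF assms] by (rule inj_on_subset) auto
  show "to_nat_on I ` {i \<in> I. to_nat_on I i \<le> n} \<subseteq> {..n}"
    by auto
qed simp

lemma
  assumes "countable I" "\<And>F. finite F \<Longrightarrow> F \<subseteq> I \<Longrightarrow> cofinal_blocks (\<Inter>i\<in>F. Z i)"
  shows block_seq_diag_seq: "block_seq (diag_seq I Z)"
    and diag_seq_in: "\<And>i n. i \<in> I \<Longrightarrow> to_nat_on I i \<le> n \<Longrightarrow> diag_seq I Z n \<in> Z i"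
proof -
  have cofinal: "cofinal_blocks (\<Inter>i\<in>{i \<in> I. to_nat_on I i \<le> n}. Z i)" for n
    by (rule assms(2)[OF finite_to_nat_on_le[OF assms(1)]]) auto
  show "block_seq (diag_seq I Z)"
    unfolding diag_seq_def by (rule block_seq_greedy_seq[OF cofinal])
  show "diag_seq I Z n \<in> Z i" if "i \<in> I" "to_nat_on I i \<le> n" for i n
    using greedy_seq_in[OF cofinal, where n = n] that by (auto simp: diag_seq_def)
qed

lemma measurable_diag_seq:
  assumes "countable I" "\<And>i. i \<in> I \<Longrightarrow> setwise_measurable M (\<lambda>s. Z s i)"
  shows "(\<lambda>s. diag_seq I (Z s) n) \<in> M \<rightarrow>\<^sub>M count_space fin_sets"
  unfolding diag_seq_def
  by (intro measurable_greedy_seq setwise_measurable_INT finite_to_nat_on_le assms) auto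

section \<open>Ultrafilters without countable bases\<close>

lemma infinite_sets_distinct_representatives:
  fixes S :: "nat \<Rightarrow> 'a set"
  assumes "\<And>n. infinite (S n)"
  obtains r where "inj r" "\<And>n. r n \<in> S n"
proof -
  have "\<exists>r. \<forall>n. r n \<in> S n - r ` {..<n}"
  proof (rule dependent_wf_choice[OF wf])
    fix f g :: "nat \<Rightarrow> 'a" and n r
    assume "\<And>m. (m, n) \<in> {(m, n). m < n} \<Longrightarrow> f m = g m"
    then have "f ` {..<n} = g ` {..<n}"
      by (auto intro!: image_cong)
    then show "(r \<in> S n - f ` {..<n}) = (r \<in> S n - g ` {..<n})"
      by simp
  next
    fix n and f :: "nat \<Rightarrow> 'a"
    have "infinite (S n - f ` {..<n})"
      using assms by simp
    then show "\<exists>r. r \<in> S n - f ` {..<n}"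
      using infinite_imp_nonempty by blast
  qed
  then obtain r where r: "\<And>n. r n \<in> S n" "\<And>n. r n \<notin> r ` {..<n}"
    by blast
  have "inj r"
    by (rule linorder_injI) (metis imageI lessThan_iff r(2))
  then show ?thesis
    using r(1) that by blast
qed

lemma splitting_set_for_countable_family:
  assumes "countable B" "\<And>b. b \<in> B \<Longrightarrow> infinite b"
  obtains A where "\<And>b. b \<in> B \<Longrightarrow> b \<inter> A \<noteq> {} \<and> \<not> b \<subseteq> A"
proof (cases "B = {}")
  case False
  define b where "b = from_nat_into B"
  have "infinite (b (n div 2))" for n
    using assms(2) from_nat_into[OF False] by (simp add: b_def)
  then obtain r where r: "inj r" "\<And>n. r n \<in> b (n div 2)"
    using infinite_sets_distinct_representatives[of "\<lambda>n. b (n div 2)"] by blast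
  define A where "A = range (\<lambda>n. r (2 * n))"
  have "b n \<inter> A \<noteq> {} \<and> \<not> b n \<subseteq> A" for n
  proof -
    have "r (2 * n) \<in> b n" "r (2 * n + 1) \<in> b n"
      using r(2)[of "2 * n"] r(2)[of "2 * n + 1"] by simp_all
    moreover have "r (2 * n + 1) \<noteq> r (2 * k)" for k
      using inj_eq[OF r(1)] by presburger
    ultimately show ?thesis
      unfolding A_def by blast
  qed
  moreover have "\<exists>n. b n = c" if "c \<in> B" for c
    unfolding b_def by (rule from_nat_into_surj[OF assms(1) that])
  ultimately show ?thesis
    by (metis that)
qed (use that in blast)

lemma uncountable_filter_base:
  assumes u: "ultrafilter_on S u" "\<And>A. A \<in> u \<Longrightarrow> infinite A" and B: "filter_base u B"
  shows "uncountable B"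
proof
  assume "countable B"
  then obtain A where A: "\<And>b. b \<in> B \<Longrightarrow> b \<inter> A \<noteq> {} \<and> \<not> b \<subseteq> A"
    using splitting_set_for_countable_family[of B] u(2) B unfolding filter_base_def by blast
  have "\<forall>A. A \<subseteq> S \<longrightarrow> A \<in> u \<or> S - A \<in> u"
    using u(1) by (simp add: ultrafilter_on_def)
  then have "S \<inter> A \<in> u \<or> S - S \<inter> A \<in> u"
    by simp
  then obtain b where "b \<in> B" "b \<subseteq> S \<inter> A \<or> b \<subseteq> S - S \<inter> A"
    using B unfolding filter_base_def by blast
  then show False
    using A[of b] by blast
qed

section \<open>The ultrafilter of a reaping tower\<close>

locale reaping_tower =
  fixes X :: "'i::linorder \<Rightarrow> nat set set"
  assumes block_family: "block_family (X \<alpha>)"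
    and almost_decreasing: "\<xi> < \<alpha> \<Longrightarrow> X \<alpha> \<subseteq>\<^sup>* FU (X \<xi>)"
    and reaping: "A \<subseteq> fin_sets \<Longrightarrow> \<exists>\<alpha>. FU_reaped A (X \<alpha>)"
begin

definition ult :: "nat set set set" where
  "ult = {A. A \<subseteq> fin_sets \<and> (\<exists>\<alpha> p. finite p \<and> FU (tail p (X \<alpha>)) \<subseteq> A)}"

lemma ordered: "ordered_family (X \<alpha>)"
  using block_family by (simp add: block_family_def)

lemma FU_tail_in_ult:
  assumes "finite p"
  shows "FU (tail p (X \<alpha>)) \<in> ult"
proof -
  have "tail p (X \<alpha>) \<subseteq> fin_sets"
    using ordered tail_subset unfolding ordered_family_def by blast
  then show ?thesis
    using assms FU_subset_fin_sets by (auto simp: ult_def)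
qed

lemma FU_in_ult: "FU (X \<alpha>) \<in> ult"
  using FU_tail_in_ult[of "{}"] by (simp add: tail_empty)

lemma FU_tail_directed:
  assumes "\<xi> \<le> \<alpha>" "finite p"
  shows "\<exists>q. finite q \<and> FU (tail q (X \<alpha>)) \<subseteq> FU (tail p (X \<xi>))"
proof (cases "\<xi> = \<alpha>")
  case False
  then have "X \<alpha> \<subseteq>\<^sup>* FU (X \<xi>)"
    using assms(1) by (intro almost_decreasing) simp
  then show ?thesis
    by (rule almost_subset_imp_FU_tail_subset[OF ordered _ assms(2)])
qed (use assms(2) in blast)

lemma ult_imp_infinite:
  assumes "A \<in> ult"
  shows "infinite A"
proof -
  obtain \<alpha> p where "finite p" "FU (tail p (X \<alpha>)) \<subseteq> A"
    using assms by (auto simp: ult_def)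
  moreover from this have "infinite (tail p (X \<alpha>))"
    using block_family_tail[OF block_family] by (simp add: block_family_def)
  ultimately show ?thesis
    using subset_FU by (meson infinite_super order_trans)
qed

lemma ult_Int:
  assumes "A \<in> ult" "B \<in> ult"
  shows "A \<inter> B \<in> ult"
proof -
  obtain \<alpha> p \<beta> q where A: "finite p" "FU (tail p (X \<alpha>)) \<subseteq> A"
    and B: "finite q" "FU (tail q (X \<beta>)) \<subseteq> B"
    using assms unfolding ult_def by blast
  define \<gamma> where "\<gamma> = max \<alpha> \<beta>"
  obtain p' q' where "finite p'" "FU (tail p' (X \<gamma>)) \<subseteq> A" "finite q'" "FU (tail q' (X \<gamma>)) \<subseteq> B"
    using FU_tail_directed[of \<alpha> \<gamma> p] FU_tail_directed[of \<beta> \<gamma> q] A B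
    by (metis \<gamma>_def max.cobounded1 max.cobounded2 order_trans)
  then have "finite (p' \<union> q')" "FU (tail (p' \<union> q') (X \<gamma>)) \<subseteq> A \<inter> B"
    by (auto simp: FU_tail_Un)
  then show ?thesis
    using assms(1) unfolding ult_def by blast
qed

lemma ult_total:
  assumes "A \<subseteq> fin_sets"
  shows "A \<in> ult \<or> fin_sets - A \<in> ult"
proof -
  obtain \<alpha> where "FU (X \<alpha>) \<subseteq> A \<or> FU (X \<alpha>) \<inter> A = {}"
    using reaping[OF assms] by (auto simp: FU_reaped_def)
  moreover have "FU (X \<alpha>) \<subseteq> fin_sets"
    using FU_in_ult by (auto simp: ult_def)
  ultimately have "FU (tail {} (X \<alpha>)) \<subseteq> A \<or> FU (tail {} (X \<alpha>)) \<subseteq> fin_sets - A"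
    by (auto simp: tail_empty)
  then show ?thesis
    using assms unfolding ult_def by blast
qed

lemma ultrafilter_ult: "ultrafilter_on fin_sets ult"
  unfolding ultrafilter_on_def
proof (intro conjI ballI allI impI)
  show subset: "ult \<subseteq> Pow fin_sets"
    by (auto simp: ult_def)
  show superset: "B \<in> ult" if "A \<in> ult" "A \<subseteq> B \<and> B \<subseteq> fin_sets" for A B
    using that by (simp add: ult_def) (meson order_trans)
  show "fin_sets \<in> ult"
    by (rule superset[OF FU_in_ult]) (use subset FU_in_ult in blast)
  show "{} \<notin> ult"
    using ult_imp_infinite by blast
qed (simp_all add: ult_Int ult_total)

lemma ordered_union_ultrafilter_ult: "ordered_union_ultrafilter ult"
  unfolding ordered_union_ultrafilter_def
proof (intro conjI ballI ultrafilter_ult)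
  fix A assume "A \<in> ult"
  then obtain \<alpha> p where "finite p" "FU (tail p (X \<alpha>)) \<subseteq> A"
    by (auto simp: ult_def)
  then show "\<exists>X. infinite X \<and> ordered_family X \<and> FU X \<subseteq> A \<and> FU X \<in> ult"
    using block_family_tail[OF block_family] FU_tail_in_ult unfolding block_family_def by blast
qed

lemma union_ultrafilter_ult: "union_ultrafilter ult"
  using ordered_union_ultrafilter_ult ordered_family_imp_pairwise_disjoint_family
  unfolding union_ultrafilter_def ordered_union_ultrafilter_def by blast

lemma stable_union_ultrafilter_ult:
  assumes bdd: "\<And>A :: 'i set. countable A \<Longrightarrow> bdd_above A"
  shows "stable_union_ultrafilter ult"
  unfolding stable_union_ultrafilter_def
proof (intro conjI allI impI union_ultrafilter_ult)
  fix Y :: "nat \<Rightarrow> nat set set"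
  assume "\<forall>n. pairwise_disjoint_family (Y n) \<and> FU (Y n) \<in> ult"
  then have "\<forall>n. \<exists>\<alpha> p. finite p \<and> FU (tail p (X \<alpha>)) \<subseteq> FU (Y n)"
    by (simp add: ult_def)
  then obtain \<alpha> p where Y: "\<And>n. finite (p n)" "\<And>n. FU (tail (p n) (X (\<alpha> n))) \<subseteq> FU (Y n)"
    by metis
  obtain \<beta> where \<beta>: "\<And>n. \<alpha> n \<le> \<beta>"
    using bdd[of "range \<alpha>"] by (auto simp: bdd_above_def)
  have "X \<beta> \<subseteq>\<^sup>* FU (Y n)" for n
  proof -
    obtain q where "finite q" "FU (tail q (X \<beta>)) \<subseteq> FU (tail (p n) (X (\<alpha> n)))"
      using FU_tail_directed[OF \<beta> Y(1)] by blast
    moreover from this have "tail q (X \<beta>) \<subseteq> FU (Y n)"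
      using Y(2) subset_FU by blast
    ultimately show ?thesis
      by (intro tail_subset_imp_almost_subset[OF ordered])
  qed
  then show "\<exists>X. pairwise_disjoint_family X \<and> FU X \<in> ult \<and> (\<forall>n. finite (X - FU (Y n)))"
    using ordered_family_imp_pairwise_disjoint_family[OF ordered] FU_in_ult
    unfolding almost_subset_def by blast
qed

lemma has_character_ult:
  assumes card: "|UNIV :: 'i set| =o cardSuc natLeq"
  shows "has_character ult (cardSuc natLeq)"
  unfolding has_character_def
proof (intro conjI allI impI)
  show lower: "cardSuc natLeq \<le>o |B|" if "filter_base ult B" for B
    using uncountable_filter_base[OF ultrafilter_ult ult_imp_infinite that]
    by (simp add: uncountable_iff_cardSuc_natLeq_ordLeq)
  define B where "B = (\<lambda>(\<alpha>, p). FU (tail p (X \<alpha>))) ` (UNIV \<times> fin_sets)"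
  have B: "filter_base ult B"
    using FU_tail_in_ult by (fastforce simp: filter_base_def B_def ult_def Fpow_def)
  have "uncountable (UNIV :: 'i set)"
    using card by (simp add: uncountable_iff_cardSuc_natLeq_ordLeq ordIso_iff_ordLeq)
  then have "infinite (UNIV :: 'i set)"
    using countable_finite by blast
  have "|B| \<le>o |(UNIV :: 'i set) \<times> fin_sets|"
    unfolding B_def by (rule card_of_image)
  also have "|(UNIV :: 'i set) \<times> fin_sets| \<le>o |UNIV :: 'i set|"
    by (intro card_of_Times_countable_ordLeq card_of_mono1 subset_refl countable_fin_sets) fact
  also note card
  finally show "\<exists>B. filter_base ult B \<and> |B| =o cardSuc natLeq"
    using B lower[OF B] ordIso_iff_ordLeq by blast
qed

end

section \<open>The tower guided by a sequence of block families\<close>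

function tower :: "(omega1 \<Rightarrow> nat set set) \<Rightarrow> omega1 \<Rightarrow> nat set set" where
  "tower g \<alpha> = block_union (diag_seq {..<\<alpha>} (\<lambda>\<xi>. FU (tower g \<xi>))) ` g \<alpha>"
  by auto
termination
  by (relation "inv_image {(\<xi>, \<alpha>). \<xi> < \<alpha>} snd") (auto intro: wf)

declare tower.simps [simp del]

lemma
  assumes g: "\<And>\<alpha>. block_family (g \<alpha>)"
  shows block_family_tower: "block_family (tower g \<alpha>)"
    and tower_almost_subset_FU: "\<xi> < \<alpha> \<Longrightarrow> tower g \<alpha> \<subseteq>\<^sup>* FU (tower g \<xi>)"
proof -
  have "block_family (tower g \<alpha>) \<and> (\<forall>\<xi><\<alpha>. tower g \<alpha> \<subseteq>\<^sup>* FU (tower g \<xi>))"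
  proof (induction \<alpha> rule: less_induct)
    case (less \<alpha>)
    define y where "y = diag_seq {..<\<alpha>} (\<lambda>\<xi>. FU (tower g \<xi>))"
    have tower: "tower g \<alpha> = block_union y ` g \<alpha>"
      by (simp add: tower.simps[of g \<alpha>] y_def)
    have cofinal: "cofinal_blocks (\<Inter>\<xi>\<in>F. FU (tower g \<xi>))" if "finite F" "F \<subseteq> {..<\<alpha>}" for F
      using that less.IH by (intro cofinal_blocks_INT_FU) auto
    have "block_seq y"
      unfolding y_def by (rule block_seq_diag_seq[OF countable_lessThan_omega1 cofinal])
    then have "block_family (tower g \<alpha>)"
      unfolding tower by (rule block_family_image_block_union[OF _ g])
    moreover have "tower g \<alpha> \<subseteq>\<^sup>* FU (tower g \<xi>)" if "\<xi> < \<alpha>" for \<xi>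
      unfolding tower
    proof (rule almost_subset_image_block_union)
      show "ordered_family (g \<alpha>)"
        using g by (simp add: block_family_def)
      show "y n \<in> FU (tower g \<xi>)" if "to_nat_on {..<\<alpha>} \<xi> \<le> n" for n
        unfolding y_def
        by (rule diag_seq_in[OF countable_lessThan_omega1 cofinal]) (use that \<open>\<xi> < \<alpha>\<close> in auto)
    qed
    ultimately show ?case
      by blast
  qed
  then show "block_family (tower g \<alpha>)" "\<xi> < \<alpha> \<Longrightarrow> tower g \<alpha> \<subseteq>\<^sup>* FU (tower g \<xi>)"
    by blast+
qed

section \<open>Coding towers by points of \<open>2\<^bsup>\<omega>\<^sub>1\<^esup>\<close>\<close>

text \<open>The tower occupies the indices \<open>Some \<xi>\<close>, the set to be reaped the index \<open>None\<close>.\<close>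

definition encode ::
    "(omega1 option \<times> nat set \<Rightarrow> omega1) \<Rightarrow> (omega1 option \<Rightarrow> nat set set) \<Rightarrow> omega1 \<Rightarrow> bool" where
  "encode e Z \<beta> \<longleftrightarrow> \<beta> \<in> e ` Sigma UNIV Z"

definition decode ::
    "(omega1 option \<times> nat set \<Rightarrow> omega1) \<Rightarrow> (omega1 \<Rightarrow> bool) \<Rightarrow> omega1 option \<Rightarrow> nat set set" where
  "decode e s i = {z \<in> fin_sets. s (e (i, z))}"

definition code_closed :: "(omega1 option \<times> nat set \<Rightarrow> omega1) \<Rightarrow> omega1 \<Rightarrow> bool" where
  "code_closed e \<alpha> \<longleftrightarrow> e ` (insert None (Some ` {..<\<alpha>}) \<times> fin_sets) \<subseteq> {..<\<alpha>}"

text \<open>If \<open>\<alpha>\<close> is not closed, some codes lie outside the domain of the points of \<open>2\<^sup>\<alpha>\<close>.\<close>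

definition decoded_preimage ::
    "(omega1 option \<times> nat set \<Rightarrow> omega1) \<Rightarrow> omega1 \<Rightarrow> (omega1 \<Rightarrow> bool) \<Rightarrow> nat set set" where
  "decoded_preimage e \<alpha> s =
     (if code_closed e \<alpha> then
        {x \<in> fin_sets.
           block_union (diag_seq {..<\<alpha>} (\<lambda>\<xi>. decode e s (Some \<xi>))) x \<in> decode e s None}
      else {})"

lemma ex_inj_code: "\<exists>e :: omega1 option \<times> nat set \<Rightarrow> omega1. inj_on e (UNIV \<times> fin_sets)"
proof -
  have inf: "infinite (UNIV :: omega1 set)"
    using uncountable_omega1 countable_finite by blast
  let ?some = "range (Some :: omega1 \<Rightarrow> omega1 option)"
  have "infinite ?some"
    using inf by (simp add: finite_image_iff)
  from infinite_imp_bij_betw2[OF this, of None] obtain h where "bij_betw h ?some (?some \<union> {None})"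
    by blast
  then have "|?some \<union> {None}| =o |?some|"
    using card_of_ordIso ordIso_symmetric by blast
  also have "|?some| \<le>o |UNIV :: omega1 set|"
    by (rule card_of_image)
  finally have "|UNIV :: omega1 option set| \<le>o |UNIV :: omega1 set|"
    by (simp add: UNIV_option_conv)
  then have "|(UNIV :: omega1 option set) \<times> fin_sets| \<le>o |UNIV :: omega1 set|"
    by (rule card_of_Times_countable_ordLeq[OF inf _ countable_fin_sets])
  then show ?thesis
    unfolding card_of_ordLeq[symmetric] by blast
qed

lemma stationary_imp_ex_code_closed:
  assumes "stationary S"
  shows "\<exists>\<alpha>\<in>S. code_closed e \<alpha>"
proof -
  have "\<exists>\<gamma>. \<forall>z\<in>fin_sets. e (i, z) < \<gamma>" for i
    using countable_omega1_bounded[of "(\<lambda>z. e (i, z)) ` fin_sets"] countable_fin_sets by auto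
  then obtain bound where bound: "\<And>i z. z \<in> fin_sets \<Longrightarrow> e (i, z) < bound i"
    by metis
  obtain \<alpha> where "\<alpha> \<in> S" and \<alpha>: "bound None < \<alpha>" "\<And>\<xi>. \<xi> < \<alpha> \<Longrightarrow> bound (Some \<xi>) < \<alpha>"
    using assms club_closed_points[of "bound None" "\<lambda>\<xi>. bound (Some \<xi>)"]
    unfolding stationary_def by blast
  have "e (i, z) < \<alpha>" if "i \<in> insert None (Some ` {..<\<alpha>})" "z \<in> fin_sets" for i z
  proof -
    have "bound i < \<alpha>"
      using that(1) \<alpha> by auto
    with bound[OF that(2)] show ?thesis
      by (rule order.strict_trans)
  qed
  then have "code_closed e \<alpha>"
    by (auto simp: code_closed_def)
  then show ?thesis
    using \<open>\<alpha> \<in> S\<close> by blast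
qed

lemma decode_encode:
  assumes e: "inj_on e (UNIV \<times> fin_sets)" and Z: "\<And>i. Z i \<subseteq> fin_sets"
    and \<alpha>: "code_closed e \<alpha>" and i: "i \<in> insert None (Some ` {..<\<alpha>})"
  shows "decode e (restrict (encode e Z) {..<\<alpha>}) i = Z i"
proof -
  have "restrict (encode e Z) {..<\<alpha>} (e (i, z)) \<longleftrightarrow> z \<in> Z i" if "z \<in> fin_sets" for z
  proof -
    have "e (i, z) < \<alpha>"
      using \<alpha> i that by (auto simp: code_closed_def)
    moreover have "e (i, z) \<in> e ` Sigma UNIV Z \<longleftrightarrow> (i, z) \<in> Sigma UNIV Z"
      by (rule inj_on_image_mem_iff[OF e]) (use Z that in auto)
    ultimately show ?thesis
      by (simp add: encode_def)
  qed
  then show ?thesis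
    using Z[of i] by (auto simp: decode_def simp del: restrict_apply)
qed

lemma setwise_measurable_decode:
  assumes "code_closed e \<alpha>" "i \<in> insert None (Some ` {..<\<alpha>})"
  shows "setwise_measurable (borel_algebra (cantor_space {..<\<alpha>})) (\<lambda>s. decode e s i)"
  unfolding setwise_measurable_def
proof
  fix z :: "nat set" assume z: "z \<in> fin_sets"
  then have "e (i, z) \<in> {..<\<alpha>}"
    using assms by (auto simp: code_closed_def)
  from pred_cantor_space_component[OF this]
  show "Measurable.pred (borel_algebra (cantor_space {..<\<alpha>})) (\<lambda>s. z \<in> decode e s i)"
    using z by (simp add: decode_def)
qed

lemma setwise_measurable_decoded_preimage:
  "setwise_measurable (borel_algebra (cantor_space {..<\<alpha>})) (decoded_preimage e \<alpha>)"
proof (cases "code_closed e \<alpha>")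
  case True
  let ?M = "borel_algebra (cantor_space {..<\<alpha>})"
  have "Measurable.pred ?M (\<lambda>s. x \<in> decoded_preimage e \<alpha> s)" if x: "x \<in> fin_sets" for x
  proof -
    have "(\<lambda>s. diag_seq {..<\<alpha>} (\<lambda>\<xi>. decode e s (Some \<xi>)) n) \<in> ?M \<rightarrow>\<^sub>M count_space fin_sets" for n
      by (intro measurable_diag_seq countable_lessThan_omega1 setwise_measurable_decode[OF True])
        simp
    then have "(\<lambda>s. block_union (diag_seq {..<\<alpha>} (\<lambda>\<xi>. decode e s (Some \<xi>))) x)
        \<in> ?M \<rightarrow>\<^sub>M count_space fin_sets"
      using x by (intro measurable_block_union) (auto simp: Fpow_def)
    then show ?thesis
      using True x pred_in_setwise_measurable[OF setwise_measurable_decode[OF True]]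
      by (simp add: decoded_preimage_def)
  qed
  then show ?thesis
    by (simp add: setwise_measurable_def)
qed (simp add: setwise_measurable_def decoded_preimage_def)

lemma borel_on_levels_decoded_preimage: "borel_on_levels (decoded_preimage e)"
  unfolding borel_on_levels_def
proof (intro allI conjI)
  fix \<alpha> :: omega1
  show "decoded_preimage e \<alpha> \<in> topspace (cantor_space {..<\<alpha>}) \<rightarrow> Pow fin_sets"
    by (auto simp: decoded_preimage_def)
  show "(\<lambda>s. \<lambda>x\<in>fin_sets. x \<in> decoded_preimage e \<alpha> s)
      \<in> borel_algebra (cantor_space {..<\<alpha>}) \<rightarrow>\<^sub>M borel_algebra (cantor_space fin_sets)"
    using setwise_measurable_decoded_preimage[of \<alpha> e]
    by (intro measurable_into_cantor_space countable_fin_sets)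
      (auto simp: topspace_cantor_space setwise_measurable_def)
qed

lemma tower_reaping:
  assumes e: "inj_on e (UNIV \<times> fin_sets)" and g: "\<And>\<alpha>. block_family (g \<alpha>)"
    and stat: "\<And>f. stationary {\<alpha>. FU_reaped (decoded_preimage e \<alpha> (restrict f {..<\<alpha>})) (g \<alpha>)}"
    and A: "A \<subseteq> fin_sets"
  shows "\<exists>\<alpha>. FU_reaped A (tower g \<alpha>)"
proof -
  define Z where "Z = case_option A (\<lambda>\<xi>. FU (tower g \<xi>))"
  have "tower g \<xi> \<subseteq> fin_sets" for \<xi>
    using block_family_tower[of g, OF g] by (auto simp: block_family_def ordered_family_def)
  then have Z: "Z i \<subseteq> fin_sets" for i
    using A FU_subset_fin_sets by (auto simp: Z_def split: option.split)
  obtain \<alpha> where closed: "code_closed e \<alpha>"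
    and reaped: "FU_reaped (decoded_preimage e \<alpha> (restrict (encode e Z) {..<\<alpha>})) (g \<alpha>)"
    using stationary_imp_ex_code_closed[OF stat[of "encode e Z"]] by blast
  define s where "s = restrict (encode e Z) {..<\<alpha>}"
  define y where "y = diag_seq {..<\<alpha>} (\<lambda>\<xi>. FU (tower g \<xi>))"
  have decode: "decode e s i = Z i" if "i \<in> insert None (Some ` {..<\<alpha>})" for i
    unfolding s_def by (rule decode_encode[OF e Z closed that])
  have "diag_seq {..<\<alpha>} (\<lambda>\<xi>. decode e s (Some \<xi>)) = y"
    unfolding y_def by (rule diag_seq_cong) (simp_all add: decode, simp add: Z_def)
  then have "decoded_preimage e \<alpha> s = {x \<in> fin_sets. block_union y x \<in> A}"
    using closed decode[of None] by (simp add: decoded_preimage_def Z_def)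
  moreover have "g \<alpha> \<subseteq> fin_sets"
    using g by (auto simp: block_family_def ordered_family_def)
  ultimately have "FU_reaped A (block_union y ` g \<alpha>)"
    using reaped by (simp add: FU_reaped_image_block_union s_def)
  then show ?thesis
    by (metis tower.simps y_def)
qed

theorem theorem3p4:
  assumes "diamond_hom_H"
  shows "\<exists>u. ordered_union_ultrafilter u \<and> stable_union_ultrafilter u \<and>
             has_character u (cardSuc natLeq)"
proof -
  obtain e :: "omega1 option \<times> nat set \<Rightarrow> omega1" where e: "inj_on e (UNIV \<times> fin_sets)"
    using ex_inj_code by blast
  obtain g where g: "\<And>\<alpha>. block_family (g \<alpha>)"
    and stat: "\<And>f. stationary {\<alpha>. FU_reaped (decoded_preimage e \<alpha> (restrict f {..<\<alpha>})) (g \<alpha>)}"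
    using assms borel_on_levels_decoded_preimage[of e]
    unfolding diamond_hom_H_def block_family_def by blast
  interpret reaping_tower "tower g"
    by unfold_locales
      (fact block_family_tower[OF g], fact tower_almost_subset_FU[OF g],
        fact tower_reaping[OF e g stat])
  have "bdd_above A" if "countable A" for A :: "omega1 set"
    using countable_omega1_bounded[OF that] by (auto simp: bdd_above_def intro: less_imp_le)
  then show ?thesis
    using ordered_union_ultrafilter_ult stable_union_ultrafilter_ult
      has_character_ult[OF card_of_UNIV_omega1] by blast
qed

end
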